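(* Let $w\in L^1(\mathbb{T}^N)$ be a non-negative function and let $\Omega\subset\mathbb{T}^N$ be measurable with $|\Omega|\ne0$. Then there is a constant $C$, which may depend on $w$ and $\Omega$ but does not depend on $\varepsilon$, such that for every $\varepsilon>0$ for which $w^\varepsilon>0$ on $\Omega$, $$\left\|\frac{w^\varepsilon-w}{w^\varepsilon}\right\|_{L^1(\Omega)}\le C.$$
   Context: $\mathbb{T}^N$ is the $N$-dimensional torus. $\eta\in C_c^\infty(\mathbb{R}^N)$ is a fixed nonnegative radial function of integral $1$ with $\eta(x)=1$ for $|x|\le\frac13$ and $\eta(x)=0$ for $|x|\ge1$; $\eta^\varepsilon(x)=\varepsilon^{-N}\eta(x/\varepsilon)$ and $w^\varepsilon:=\eta^\varepsilon*w$. *)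

theory Defs
  imports "HOL-Analysis.Analysis"
begin

text \<open>
  The torus is \<open>\<real>\<^sup>N / \<int>\<^sup>N\<close> with \<open>N = CARD('n)\<close>. A function on it is a \<open>\<int>\<^sup>N\<close>-periodic function on
  \<open>\<real>\<^sup>N\<close>, a subset of it is a \<open>\<int>\<^sup>N\<close>-invariant subset of \<open>\<real>\<^sup>N\<close>, and its measure is Lebesgue measure
  on the fundamental cell \<open>[0,1)\<^sup>N\<close>.
\<close>

definition int_lattice :: "(real^'n) set" where
  "int_lattice = {k. \<forall>i. k $ i \<in> \<int>}"

definition fund_cell :: "(real^'n) set" where
  "fund_cell = {x. \<forall>i. 0 \<le> x $ i \<and> x $ i < 1}"

definition periodic_fun :: "(real^'n \<Rightarrow> 'b) \<Rightarrow> bool" where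
  "periodic_fun f \<longleftrightarrow> (\<forall>x. \<forall>k\<in>int_lattice. f (x + k) = f x)"

definition measurable_torus_set :: "(real^'n) set \<Rightarrow> bool" where
  "measurable_torus_set A \<longleftrightarrow> periodic_fun (\<lambda>x. x \<in> A) \<and> A \<in> sets lebesgue"

definition torus_measure :: "(real^'n) set \<Rightarrow> real" where
  "torus_measure A = measure lebesgue (A \<inter> fund_cell)"

definition torus_L1 :: "(real^'n) set \<Rightarrow> (real^'n \<Rightarrow> real) \<Rightarrow> bool" where
  "torus_L1 A f \<longleftrightarrow> periodic_fun f \<and> set_integrable lebesgue (A \<inter> fund_cell) f"

text \<open>Only meaningful together with \<^const>\<open>torus_L1\<close>: the integral is \<open>0\<close> for non-integrable functions.\<close>

definition torus_L1_norm :: "(real^'n) set \<Rightarrow> (real^'n \<Rightarrow> real) \<Rightarrow> real" where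
  "torus_L1_norm A f = (LINT x:(A \<inter> fund_cell)|lebesgue. \<bar>f x\<bar>)"

primrec C_k :: "nat \<Rightarrow> ('a::euclidean_space \<Rightarrow> real) \<Rightarrow> bool" where
  "C_k 0 f \<longleftrightarrow> continuous_on UNIV f"
| "C_k (Suc k) f \<longleftrightarrow> (\<forall>x. f differentiable (at x)) \<and>
     (\<forall>b\<in>Basis. C_k k (\<lambda>x. frechet_derivative f (at x) b))"

definition C_c_infinity :: "('a::euclidean_space \<Rightarrow> real) \<Rightarrow> bool" where
  "C_c_infinity f \<longleftrightarrow> (\<forall>k. C_k k f) \<and> compact (closure {x. f x \<noteq> 0})"

definition mollifier_kernel :: "(real^'n \<Rightarrow> real) \<Rightarrow> bool" where
  "mollifier_kernel \<eta> \<longleftrightarrow>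
     C_c_infinity \<eta> \<and>
     (\<forall>x. 0 \<le> \<eta> x) \<and>
     (\<forall>x y. norm x = norm y \<longrightarrow> \<eta> x = \<eta> y) \<and>
     (LINT x|lebesgue. \<eta> x) = 1 \<and>
     (\<forall>x. norm x \<le> 1/3 \<longrightarrow> \<eta> x = 1) \<and>
     (\<forall>x. 1 \<le> norm x \<longrightarrow> \<eta> x = 0)"

definition rescaled_kernel :: "(real^'n \<Rightarrow> real) \<Rightarrow> real \<Rightarrow> real^'n \<Rightarrow> real" where
  "rescaled_kernel \<eta> \<epsilon> x = \<eta> (x /\<^sub>R \<epsilon>) / \<epsilon> ^ CARD('n)"

definition convolution :: "(real^'n \<Rightarrow> real) \<Rightarrow> (real^'n \<Rightarrow> real) \<Rightarrow> real^'n \<Rightarrow> real" where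
  "convolution f g x = (LINT y|lebesgue. f (x - y) * g y)"

text \<open>
  Convolving over \<open>\<real>\<^sup>N\<close> with the periodic \<open>w\<close> is convolution on the torus with the periodisation of
  the kernel, so this also makes sense when the support of the kernel exceeds the cell.
\<close>

definition mollify :: "(real^'n \<Rightarrow> real) \<Rightarrow> real \<Rightarrow> (real^'n \<Rightarrow> real) \<Rightarrow> real^'n \<Rightarrow> real" where
  "mollify \<eta> \<epsilon> w = convolution (rescaled_kernel \<eta> \<epsilon>) w"

end

theory Submission
  imports Defs
begin

text \<open>
  Since \<open>\<bar>w\<^sup>\<epsilon> - w\<bar> / w\<^sup>\<epsilon> \<le> 1 + w / w\<^sup>\<epsilon>\<close>, it is enough to bound the integral of \<open>w / w\<^sup>\<epsilon>\<close> over
  \<open>\<Omega>\<close>. On a single ball \<open>B\<close> of radius \<open>\<epsilon> / 6\<close> this is immediate: any two points of \<open>B\<close> are less than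
  \<open>\<epsilon> / 3\<close> apart, and there the rescaled kernel equals \<open>\<epsilon>\<close> to the power \<open>-N\<close>, so at every point of
  \<open>\<Omega> \<inter> B\<close> the value of \<open>w\<^sup>\<epsilon>\<close> is at least \<open>\<epsilon>\<close> to the power \<open>-N\<close> times the mass that \<open>w\<close> has on
  \<open>\<Omega> \<inter> B\<close> (lemma \<open>nn_integral_close_points_le_mollify\<close>). Dividing \<open>w\<close> by \<open>w\<^sup>\<epsilon>\<close> cancels this mass,
  and the integral of the quotient over \<open>\<Omega> \<inter> B\<close> is at most \<open>\<epsilon>\<close> to the power \<open>N\<close>, whatever \<open>w\<close> is
  (lemma \<open>nn_integral_quotient_le\<close>).

  Instead of covering the torus by such balls, one averages over their centres. By Tonelli's theorem
  and the invariance of the integral over the cell under translation of a periodic integrand, the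
  integral of \<open>w / w\<^sup>\<epsilon>\<close> over the cell is the integral over all centres in the cell of the local
  integrals, divided by the volume of one ball. That volume is \<open>\<epsilon>\<close> to the power \<open>N\<close> up to a constant
  depending only on \<open>N\<close>, so \<open>\<epsilon>\<close> cancels (lemma \<open>nn_integral_cell_quotient_le\<close>). The averaging treats
  small and large \<open>\<epsilon>\<close> alike, including balls that wrap around the torus many times, and it gives the
  explicit constant \<open>1 + 6 ^ N / V\<close>, where \<open>V\<close> is the volume of the unit ball.
\<close>

section \<open>Translations and Lebesgue measure\<close>

lemma measurable_lebesgue_translation:
  fixes a :: "'a::euclidean_space"
  shows "(\<lambda>x. x + a) \<in> lebesgue \<rightarrow>\<^sub>M lebesgue"
  using lebesgue_affine_measurable[of "\<lambda>_. 1" a]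
  by (simp add: euclidean_representation add.commute)

lemma distr_lebesgue_translation:
  fixes a :: "'a::euclidean_space"
  shows "distr lebesgue lebesgue (\<lambda>x. x + a) = lebesgue"
  using lebesgue_affine_euclidean[of "\<lambda>_. 1" a]
  by (simp add: euclidean_representation add.commute density_1)

lemma AE_lebesgue_translation:
  fixes a :: "'a::euclidean_space"
  assumes "AE x in lebesgue. P x"
  shows "AE x in lebesgue. P (x + a)"
  by (rule AE_distrD[OF measurable_lebesgue_translation[of a]])
    (simp only: distr_lebesgue_translation assms)

lemma nn_integral_lebesgue_translation:
  fixes a :: "'a::euclidean_space"
  assumes "f \<in> borel_measurable lebesgue"
  shows "(\<integral>\<^sup>+x. f (x + a) \<partial>lebesgue) = (\<integral>\<^sup>+x. f x \<partial>lebesgue)"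
  using nn_integral_distr[OF measurable_lebesgue_translation[of a]] assms
  by (simp add: distr_lebesgue_translation)

lemma integral_lebesgue_translation:
  fixes a :: "'a::euclidean_space" and f :: "'a \<Rightarrow> real"
  assumes "f \<in> borel_measurable lebesgue"
  shows "(LINT x|lebesgue. f (x + a)) = (LINT x|lebesgue. f x)"
  using integral_distr[OF measurable_lebesgue_translation[of a] assms]
  by (simp add: distr_lebesgue_translation)

text \<open>
  The map \<open>(x, u) \<mapsto> g (x + u)\<close> need not be measurable for the product of the completed
  \<open>\<sigma>\<close>-algebras. So \<open>g\<close> is replaced by a Borel function \<open>h\<close> that agrees with it almost everywhere;
  the inner integrals do not change, because translates of null sets are null sets.
\<close>

lemma Tonelli_lebesgue_translation:
  fixes g :: "'a::euclidean_space \<Rightarrow> ennreal"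
  assumes g: "g \<in> borel_measurable lebesgue"
    and [measurable]: "A \<in> sets borel" "B \<in> sets borel"
  shows "(\<integral>\<^sup>+x\<in>A. (\<integral>\<^sup>+u\<in>B. g (x + u) \<partial>lebesgue) \<partial>lebesgue)
       = (\<integral>\<^sup>+u\<in>B. (\<integral>\<^sup>+x\<in>A. g (x + u) \<partial>lebesgue) \<partial>lebesgue)"
proof -
  obtain h where [measurable]: "h \<in> borel_measurable borel" and h: "AE x in lborel. g x = h x"
    using completion_ex_borel_measurable[OF g] by auto
  have ae: "AE x in lborel. g (x + a) = h (x + a)" for a
    using AE_lebesgue_translation[of "\<lambda>x. g x = h x" a] h by (simp add: AE_completion_iff)
  have ae': "AE x in lborel. g (a + x) = h (a + x)" for a
    using ae[of a] by (simp add: add.commute)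
  have 1: "(\<integral>\<^sup>+u\<in>B. g (x + u) \<partial>lborel) = (\<integral>\<^sup>+u\<in>B. h (x + u) \<partial>lborel)" for x
    by (intro nn_integral_cong_AE) (use ae'[of x] in auto)
  have 2: "(\<integral>\<^sup>+x\<in>A. g (x + u) \<partial>lborel) = (\<integral>\<^sup>+x\<in>A. h (x + u) \<partial>lborel)" for u
    by (intro nn_integral_cong_AE) (use ae[of u] in auto)
  have "(\<integral>\<^sup>+x. (\<integral>\<^sup>+u. h (x + u) * indicator B u * indicator A x \<partial>lborel) \<partial>lborel)
      = (\<integral>\<^sup>+u. (\<integral>\<^sup>+x. h (x + u) * indicator B u * indicator A x \<partial>lborel) \<partial>lborel)"
    by (rule lborel_pair.Fubini'[symmetric]) measurable
  also have "(\<integral>\<^sup>+u. (\<integral>\<^sup>+x. h (x + u) * indicator B u * indicator A x \<partial>lborel) \<partial>lborel)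
      = (\<integral>\<^sup>+u\<in>B. (\<integral>\<^sup>+x\<in>A. h (x + u) \<partial>lborel) \<partial>lborel)"
    by (subst nn_integral_multc[symmetric]) (auto simp: ac_simps)
  also have "(\<integral>\<^sup>+x. (\<integral>\<^sup>+u. h (x + u) * indicator B u * indicator A x \<partial>lborel) \<partial>lborel)
      = (\<integral>\<^sup>+x\<in>A. (\<integral>\<^sup>+u\<in>B. h (x + u) \<partial>lborel) \<partial>lborel)"
    by (subst nn_integral_multc) auto
  finally show ?thesis
    by (simp add: nn_integral_completion 1 2)
qed

section \<open>The lattice and the fundamental cell\<close>

lemma countable_int_lattice: "countable (int_lattice :: (real^'n) set)"
proof -
  have "int_lattice \<subseteq> range (\<lambda>f::'n \<Rightarrow> int. \<chi> i. of_int (f i))"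
  proof
    fix k :: "real^'n" assume "k \<in> int_lattice"
    then have "k = (\<chi> i. of_int \<lfloor>k $ i\<rfloor>)"
      by (simp add: int_lattice_def vec_eq_iff)
    then show "k \<in> range (\<lambda>f::'n \<Rightarrow> int. \<chi> i. of_int (f i))"
      by (intro range_eqI[where x="\<lambda>i. \<lfloor>k $ i\<rfloor>"])
  qed
  then show ?thesis
    by (rule countable_subset) simp
qed

lemma int_lattice_uminus: "k \<in> int_lattice \<Longrightarrow> - k \<in> int_lattice"
  by (simp add: int_lattice_def)

lemma zero_in_int_lattice: "0 \<in> int_lattice"
  by (simp add: int_lattice_def)

lemma periodic_funD: "periodic_fun f \<Longrightarrow> k \<in> int_lattice \<Longrightarrow> f (x + k) = f x"
  by (simp add: periodic_fun_def)

lemma ex1_lattice_translate_in_cell: "\<exists>!k\<in>int_lattice. x + k \<in> fund_cell" for x :: "real^'n"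
proof (rule ex1I)
  show "(\<chi> i. - of_int \<lfloor>x $ i\<rfloor>) \<in> int_lattice \<and> x + (\<chi> i. - of_int \<lfloor>x $ i\<rfloor>) \<in> fund_cell"
    by (auto simp: int_lattice_def fund_cell_def) linarith+
next
  fix k :: "real^'n" assume k: "k \<in> int_lattice \<and> x + k \<in> fund_cell"
  show "k = (\<chi> i. - of_int \<lfloor>x $ i\<rfloor>)"
  proof (subst vec_eq_iff, rule allI)
    fix i
    from k obtain m where m: "k $ i = of_int m"
      by (auto simp: int_lattice_def elim: Ints_cases)
    have "0 \<le> x $ i + k $ i" "x $ i + k $ i < 1"
      using k by (auto simp: fund_cell_def)
    then have "\<lfloor>x $ i\<rfloor> = - m"
      unfolding m by linarith
    with m show "k $ i = (\<chi> i. - of_int \<lfloor>x $ i\<rfloor>) $ i" by simp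
  qed
qed

lemma fund_cell_borel [measurable]: "fund_cell \<in> sets (borel :: (real^'n) measure)"
  unfolding fund_cell_def by measurable

lemma emeasure_fund_cell_le_1: "emeasure lebesgue (fund_cell :: (real^'n) set) \<le> 1"
proof -
  have "emeasure lborel (fund_cell :: (real^'n) set) \<le> emeasure lborel (cbox 0 (1::real^'n))"
    by (intro emeasure_mono) (auto simp: fund_cell_def mem_box_cart less_imp_le)
  also have "\<dots> = 1"
  proof -
    have "emeasure lborel (cbox 0 (1::real^'n)) = (\<Prod>b\<in>Basis. ((1::real^'n) - 0) \<bullet> b)"
      by (intro emeasure_lborel_cbox) (auto simp: Basis_vec_def inner_axis)
    also have "(\<Prod>b\<in>Basis. ((1::real^'n) - 0) \<bullet> b) = 1"
      by (intro prod.neutral) (auto simp: Basis_vec_def inner_axis)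
    finally show ?thesis by simp
  qed
  finally show ?thesis by simp
qed

text \<open>
  The lattice translates of the cell tile the space. The sum over the lattice is written as an
  integral for the counting measure, so that it can be exchanged with the Lebesgue integral.
\<close>

lemma nn_integral_indicator_lattice_translates:
  fixes x :: "real^'n"
  shows "(\<integral>\<^sup>+k. indicator fund_cell (x + k) \<partial>count_space int_lattice) = 1"
    and "(\<integral>\<^sup>+k. indicator fund_cell (x - k) \<partial>count_space int_lattice) = 1"
proof -
  obtain k0 where k0: "k0 \<in> int_lattice" "x + k0 \<in> fund_cell"
    and uniq: "\<And>k. k \<in> int_lattice \<Longrightarrow> x + k \<in> fund_cell \<Longrightarrow> k = k0"
    using ex1_lattice_translate_in_cell[of x] by blast
  have uniq': "k = - k0" if "k \<in> int_lattice" "x - k \<in> fund_cell" for k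
    using uniq[of "- k"] that int_lattice_uminus[of k] by (auto simp: equation_minus_iff)
  have sing: "(\<integral>\<^sup>+k. indicator {l} k \<partial>count_space int_lattice) = (1 :: ennreal)"
    if "l \<in> int_lattice" for l :: "real^'n"
    using that by simp
  have "(\<integral>\<^sup>+k. indicator fund_cell (x + k) \<partial>count_space int_lattice)
      = (\<integral>\<^sup>+k. indicator {k0} k \<partial>count_space int_lattice)"
    using k0 by (intro nn_integral_cong) (auto simp: indicator_def dest: uniq)
  then show "(\<integral>\<^sup>+k. indicator fund_cell (x + k) \<partial>count_space int_lattice) = 1"
    using sing[of k0] k0 by simp
  have "(\<integral>\<^sup>+k. indicator fund_cell (x - k) \<partial>count_space int_lattice)
      = (\<integral>\<^sup>+k. indicator {- k0} k \<partial>count_space int_lattice)"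
    using k0 by (intro nn_integral_cong) (auto simp: indicator_def dest: uniq')
  then show "(\<integral>\<^sup>+k. indicator fund_cell (x - k) \<partial>count_space int_lattice) = 1"
    by (simp only: sing[OF int_lattice_uminus[OF k0(1)]])
qed

text \<open>
  The cell and its translate by \<open>u\<close> are both fundamental domains of the lattice. The proof cuts the
  translated cell into its intersections with the lattice translates of the cell and moves each piece
  back into the cell; as \<open>g\<close> is periodic, this does not change its integral, and the moved pieces
  tile the cell.
\<close>

lemma nn_integral_cell_translate:
  fixes g :: "real^'n \<Rightarrow> ennreal"
  assumes g[measurable]: "g \<in> borel_measurable lebesgue" and per: "periodic_fun g"
  shows "(\<integral>\<^sup>+x\<in>fund_cell. g (x + u) \<partial>lebesgue) = (\<integral>\<^sup>+x\<in>fund_cell. g x \<partial>lebesgue)"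
proof -
  let ?I = "indicator fund_cell :: real^'n \<Rightarrow> ennreal"
  let ?L = "count_space (int_lattice :: (real^'n) set)"
  have I_meas: "(\<lambda>x. ?I (x + a)) \<in> borel_measurable lebesgue" for a
  proof -
    have "(\<lambda>x. ?I (x + a)) \<in> borel_measurable borel" by measurable
    then show ?thesis by (intro measurable_completion) simp
  qed
  have [measurable]: "(\<lambda>x. ?I (x - u - k)) \<in> borel_measurable lebesgue" for k
    using I_meas[of "- u - k"] by (simp add: algebra_simps)
  note [measurable] = I_meas I_meas[of 0, simplified] I_meas[of "- u", unfolded add_uminus_conv_diff]
  have shift: "(\<integral>\<^sup>+x. g x * ?I (x - u) * ?I (x + k) \<partial>lebesgue)
      = (\<integral>\<^sup>+x. g x * ?I (x - u - k) * ?I x \<partial>lebesgue)" if k: "k \<in> int_lattice" for k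
  proof -
    have "(\<integral>\<^sup>+x. g x * ?I (x - u - k) * ?I x \<partial>lebesgue)
        = (\<integral>\<^sup>+x. g (x + k) * ?I ((x + k) - u - k) * ?I (x + k) \<partial>lebesgue)"
      by (rule nn_integral_lebesgue_translation[symmetric]) measurable
    also have "\<dots> = (\<integral>\<^sup>+x. g x * ?I (x - u) * ?I (x + k) \<partial>lebesgue)"
      by (simp add: periodic_funD[OF per k] algebra_simps)
    finally show ?thesis ..
  qed
  have tile: "(\<integral>\<^sup>+k. g x * ?I (x - u - k) * ?I x \<partial>?L) = g x * ?I x" for x
  proof -
    have "(\<integral>\<^sup>+k. g x * ?I (x - u - k) * ?I x \<partial>?L) = (\<integral>\<^sup>+k. (g x * ?I x) * ?I (x - u - k) \<partial>?L)"
      by (simp add: ac_simps)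
    also have "\<dots> = g x * ?I x"
      by (subst nn_integral_cmult) (auto simp: nn_integral_indicator_lattice_translates)
    finally show ?thesis .
  qed
  have "(\<integral>\<^sup>+x\<in>fund_cell. g (x + u) \<partial>lebesgue) = (\<integral>\<^sup>+x. g (x + u) * ?I ((x + u) - u) \<partial>lebesgue)"
    by simp
  also have "\<dots> = (\<integral>\<^sup>+x. g x * ?I (x - u) \<partial>lebesgue)"
    by (rule nn_integral_lebesgue_translation) measurable
  also have "\<dots> = (\<integral>\<^sup>+x. (\<integral>\<^sup>+k. g x * ?I (x - u) * ?I (x + k) \<partial>?L) \<partial>lebesgue)"
    by (subst nn_integral_cmult) (auto simp: nn_integral_indicator_lattice_translates)
  also have "\<dots> = (\<integral>\<^sup>+k. (\<integral>\<^sup>+x. g x * ?I (x - u) * ?I (x + k) \<partial>lebesgue) \<partial>?L)"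
    by (intro nn_integral_count_space_nn_integral countable_int_lattice) measurable
  also have "\<dots> = (\<integral>\<^sup>+k. (\<integral>\<^sup>+x. g x * ?I (x - u - k) * ?I x \<partial>lebesgue) \<partial>?L)"
    by (rule nn_integral_cong) (simp add: shift)
  also have "\<dots> = (\<integral>\<^sup>+x. (\<integral>\<^sup>+k. g x * ?I (x - u - k) * ?I x \<partial>?L) \<partial>lebesgue)"
    by (intro nn_integral_count_space_nn_integral[symmetric] countable_int_lattice) measurable
  also have "\<dots> = (\<integral>\<^sup>+x\<in>fund_cell. g x \<partial>lebesgue)"
    by (simp only: tile)
  finally show ?thesis .
qed

text \<open>
  Integrability on the torus only speaks about the cell, whereas the convolution integrates over the
  whole space. On each of the countably many lattice translates of the cell, a periodic function is a
  translate of its restriction to the cell, so measurability carries over.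
\<close>

lemma borel_measurable_lebesgue_if_periodic:
  fixes f :: "real^'n \<Rightarrow> real"
  assumes per: "periodic_fun f"
    and cell: "(\<lambda>x. indicator fund_cell x * f x) \<in> borel_measurable lebesgue"
  shows "f \<in> borel_measurable lebesgue"
proof (rule measurable_piecewise_restrict2)
  define k :: "nat \<Rightarrow> real^'n" where "k = from_nat_into int_lattice"
  have k: "range k = int_lattice"
    using countable_int_lattice zero_in_int_lattice
    unfolding k_def by (intro range_from_nat_into) auto
  show "{x. x + k n \<in> fund_cell} \<in> sets lebesgue" for n
  proof -
    have "{x \<in> space borel. x + k n \<in> fund_cell} \<in> sets borel" by measurable
    then show ?thesis by (simp add: sets_completionI_sets)
  qed
  show "space lebesgue = (\<Union>n. {x. x + k n \<in> fund_cell})"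
    using ex1_lattice_translate_in_cell k by fastforce
  show "\<exists>h\<in>borel_measurable lebesgue. \<forall>x\<in>{x. x + k n \<in> fund_cell}. f x = h x" for n
  proof (intro bexI ballI)
    show "(\<lambda>x. indicator fund_cell (x + k n) * f (x + k n)) \<in> borel_measurable lebesgue"
      by (rule measurable_compose[OF measurable_lebesgue_translation cell])
    fix x assume "x \<in> {x. x + k n \<in> fund_cell}"
    moreover have "f (x + k n) = f x"
      using per k by (intro periodic_funD) auto
    ultimately show "f x = indicator fund_cell (x + k n) * f (x + k n)" by simp
  qed
qed

section \<open>Mollification of periodic functions\<close>

lemma borel_measurable_convolution_integrand:
  fixes f g :: "real^'n \<Rightarrow> real"
  assumes [measurable]: "f \<in> borel_measurable borel" and g: "g \<in> borel_measurable lebesgue"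
  shows "(\<lambda>y. f (x - y) * g y) \<in> borel_measurable lebesgue"
proof -
  have "(\<lambda>y. f (x - y)) \<in> borel_measurable borel" by measurable
  then have "(\<lambda>y. f (x - y)) \<in> borel_measurable lebesgue"
    by (intro measurable_completion) simp
  with g show ?thesis by (intro borel_measurable_times)
qed

text \<open>
  Replacing \<open>g\<close> by a Borel function that agrees with it almost everywhere does not change the
  convolution, and for Borel functions the parameter integral is measurable.
\<close>

lemma borel_measurable_convolution:
  fixes f g :: "real^'n \<Rightarrow> real"
  assumes f[measurable]: "f \<in> borel_measurable borel" and g: "g \<in> borel_measurable lebesgue"
  shows "convolution f g \<in> borel_measurable borel"
proof -
  obtain h where h[measurable]: "h \<in> borel_measurable borel" and ae: "AE x in lborel. g x = h x"
    using completion_ex_borel_measurable_real[OF g] by auto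
  have hl: "h \<in> borel_measurable lebesgue"
    using h by (intro measurable_completion) simp
  have "convolution f g x = (LINT y|lborel. f (x - y) * h y)" for x
  proof -
    have "convolution f g x = (LINT y|lebesgue. f (x - y) * h y)"
      unfolding convolution_def
      using borel_measurable_convolution_integrand[OF f g] borel_measurable_convolution_integrand[OF f hl]
        AE_completion[OF ae]
      by (intro integral_cong_AE) auto
    also have "\<dots> = (LINT y|lborel. f (x - y) * h y)"
      by (intro integral_completion) measurable
    finally show ?thesis .
  qed
  moreover have "(\<lambda>x. LINT y|lborel. f (x - y) * h y) \<in> borel_measurable borel"
    by measurable
  ultimately show ?thesis by (simp cong: measurable_cong)
qed

lemma periodic_fun_convolution:
  fixes f g :: "real^'n \<Rightarrow> real"
  assumes f: "f \<in> borel_measurable borel" and g: "g \<in> borel_measurable lebesgue"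
    and per: "periodic_fun g"
  shows "periodic_fun (convolution f g)"
  unfolding periodic_fun_def
proof (intro allI ballI)
  fix x k :: "real^'n" assume k: "k \<in> int_lattice"
  have "convolution f g (x + k) = (LINT y|lebesgue. f ((x + k) - (y + k)) * g (y + k))"
    unfolding convolution_def
    by (rule integral_lebesgue_translation[symmetric]) (rule borel_measurable_convolution_integrand[OF f g])
  also have "\<dots> = convolution f g x"
    by (simp add: convolution_def periodic_funD[OF per k])
  finally show "convolution f g (x + k) = convolution f g x" .
qed

lemma borel_measurable_rescaled_kernel:
  assumes "mollifier_kernel \<eta>"
  shows "rescaled_kernel \<eta> \<epsilon> \<in> borel_measurable borel"
proof -
  have "C_k 0 \<eta>"
    using assms unfolding mollifier_kernel_def C_c_infinity_def by blast
  then have [measurable]: "\<eta> \<in> borel_measurable borel"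
    by (simp add: borel_measurable_continuous_onI)
  show ?thesis
    unfolding rescaled_kernel_def by measurable
qed

lemma borel_measurable_mollify:
  fixes w :: "real^'n \<Rightarrow> real"
  assumes "mollifier_kernel \<eta>" "w \<in> borel_measurable lebesgue"
  shows "mollify \<eta> \<epsilon> w \<in> borel_measurable lebesgue"
  unfolding mollify_def
  using borel_measurable_convolution[OF borel_measurable_rescaled_kernel assms(2)] assms(1)
  by (intro measurable_completion) simp

lemma periodic_fun_mollify:
  fixes w :: "real^'n \<Rightarrow> real"
  assumes "mollifier_kernel \<eta>" "w \<in> borel_measurable lebesgue" "periodic_fun w"
  shows "periodic_fun (mollify \<eta> \<epsilon> w)"
  unfolding mollify_def
  using assms by (intro periodic_fun_convolution borel_measurable_rescaled_kernel)

section \<open>The quotient on small balls\<close>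

text \<open>
  Within distance \<open>\<epsilon> / 3\<close> of \<open>x\<close> the integrand defining \<open>w\<^sup>\<epsilon> x\<close> is \<open>w\<close> times \<open>\<epsilon>\<close> to the power
  \<open>-N\<close>, and elsewhere it is nonnegative. The positivity assumption on \<open>w\<^sup>\<epsilon> x\<close> ensures that the
  Bochner integral is a genuine one: for a non-integrable integrand its value would be \<open>0\<close>.
\<close>

lemma nn_integral_close_points_le_mollify:
  fixes w :: "real^'n \<Rightarrow> real"
  assumes \<eta>: "mollifier_kernel \<eta>" and w: "w \<in> borel_measurable lebesgue"
    and nonneg: "AE y in lebesgue. 0 \<le> w y"
    and \<epsilon>: "0 < \<epsilon>" and pos: "0 < mollify \<eta> \<epsilon> w x"
    and B: "\<And>y. y \<in> B \<Longrightarrow> norm (x - y) \<le> \<epsilon> / 3"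
  shows "(\<integral>\<^sup>+y\<in>B. ennreal (w y) \<partial>lebesgue) \<le> ennreal (\<epsilon> ^ CARD('n) * mollify \<eta> \<epsilon> w x)"
proof -
  let ?f = "\<lambda>y. rescaled_kernel \<eta> \<epsilon> (x - y) * w y"
  have mollify: "mollify \<eta> \<epsilon> w x = (LINT y|lebesgue. ?f y)"
    by (simp add: mollify_def convolution_def)
  have int: "integrable lebesgue ?f"
    using pos not_integrable_integral_eq[of lebesgue ?f] mollify by fastforce
  have \<eta>_nonneg: "0 \<le> \<eta> y" and \<eta>_1: "norm y \<le> 1 / 3 \<Longrightarrow> \<eta> y = 1" for y
    using \<eta> unfolding mollifier_kernel_def by blast+
  have f_nonneg: "AE y in lebesgue. 0 \<le> \<epsilon> ^ CARD('n) * ?f y"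
    using nonneg by eventually_elim (use \<epsilon> \<eta>_nonneg in \<open>simp add: rescaled_kernel_def\<close>)
  have "ennreal (w y) * indicator B y \<le> ennreal (\<epsilon> ^ CARD('n) * ?f y)" for y
  proof (cases "y \<in> B")
    case True
    have "norm ((x - y) /\<^sub>R \<epsilon>) \<le> 1 / 3"
      using B[OF True] \<epsilon> by (simp del: scaleR_diff_right add: divide_simps)
    then have "\<epsilon> ^ CARD('n) * ?f y = w y"
      using \<epsilon> \<eta>_1 by (simp add: rescaled_kernel_def)
    then show ?thesis
      using True by (simp only: indicator_simps mult_1_right order_refl)
  qed simp
  then have "(\<integral>\<^sup>+y\<in>B. ennreal (w y) \<partial>lebesgue) \<le> (\<integral>\<^sup>+y. ennreal (\<epsilon> ^ CARD('n) * ?f y) \<partial>lebesgue)"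
    by (intro nn_integral_mono)
  also have "\<dots> = ennreal (LINT y|lebesgue. \<epsilon> ^ CARD('n) * ?f y)"
    using int f_nonneg by (intro nn_integral_eq_integral) auto
  also have "\<dots> = ennreal (\<epsilon> ^ CARD('n) * mollify \<eta> \<epsilon> w x)"
    by (simp only: mollify integral_mult_right_zero)
  finally show ?thesis .
qed

text \<open>
  If \<open>v\<close> is at least \<open>1 / c\<close> times the mass \<open>I\<close> of \<open>w\<close> on \<open>A\<close>, then \<open>w / v\<close> is at most \<open>c / I\<close> times \<open>w\<close>,
  and integrating cancels \<open>I\<close>. If \<open>I\<close> is \<open>0\<close>, there is nothing to cancel, but then the positive
  part of \<open>w\<close> vanishes almost everywhere on \<open>A\<close>.
\<close>

lemma nn_integral_quotient_le:
  fixes w v :: "'a \<Rightarrow> real"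
  assumes [measurable]: "w \<in> borel_measurable M" "A \<in> sets M" and c: "0 \<le> c"
    and v: "\<And>x. x \<in> A \<Longrightarrow> 0 < v x"
    and le: "\<And>x. x \<in> A \<Longrightarrow> (\<integral>\<^sup>+y\<in>A. ennreal (w y) \<partial>M) \<le> ennreal (c * v x)"
  shows "(\<integral>\<^sup>+x\<in>A. ennreal (w x / v x) \<partial>M) \<le> ennreal c"
proof (cases "A = {}")
  case False
  then obtain x0 where "x0 \<in> A" by blast
  define I where "I = enn2real (\<integral>\<^sup>+y\<in>A. ennreal (w y) \<partial>M)"
  have I: "(\<integral>\<^sup>+y\<in>A. ennreal (w y) \<partial>M) = ennreal I"
    unfolding I_def using le[OF \<open>x0 \<in> A\<close>] le_less_trans[OF _ ennreal_less_top] by simp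
  have "0 \<le> I" by (simp add: I_def)
  show ?thesis
  proof (cases "I = 0")
    case True
    with I have "(\<integral>\<^sup>+y. ennreal (w y) * indicator A y \<partial>M) = 0"
      by simp
    then have "AE x in M. ennreal (w x) * indicator A x = 0"
      by (subst (asm) nn_integral_0_iff_AE) simp_all
    then have "AE x in M. ennreal (w x / v x) * indicator A x = 0"
      by eventually_elim (use v in \<open>auto simp: indicator_def ennreal_eq_0_iff divide_nonpos_pos split: if_splits\<close>)
    then have "(\<integral>\<^sup>+x\<in>A. ennreal (w x / v x) \<partial>M) = (\<integral>\<^sup>+x. 0 \<partial>M)"
      by (rule nn_integral_cong_AE)
    then show ?thesis by simp
  next
    case False
    with \<open>0 \<le> I\<close> have "0 < I" by simp
    have "ennreal (w x / v x) * indicator A x \<le> ennreal (c / I) * (ennreal (w x) * indicator A x)" for x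
    proof (cases "x \<in> A \<and> 0 \<le> w x")
      case True
      have "I \<le> c * v x"
        using le[of x] True v[of x] c by (simp add: I)
      then have "w x * I \<le> w x * (c * v x)"
        using True by (intro mult_left_mono) auto
      then have "w x / v x \<le> c / I * w x"
        using \<open>0 < I\<close> v[of x] True by (simp add: field_simps)
      then show ?thesis
        using True c \<open>0 < I\<close> by (simp flip: ennreal_mult add: ennreal_leI)
    next
      case False
      then show ?thesis
        using v[of x] by (auto simp: indicator_def ennreal_neg divide_nonpos_pos)
    qed
    then have "(\<integral>\<^sup>+x\<in>A. ennreal (w x / v x) \<partial>M) \<le> (\<integral>\<^sup>+x. ennreal (c / I) * (ennreal (w x) * indicator A x) \<partial>M)"
      by (intro nn_integral_mono)
    also have "\<dots> = ennreal (c / I) * ennreal I"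
      by (subst nn_integral_cmult) (auto simp: I)
    also have "\<dots> = ennreal c"
      using \<open>0 < I\<close> c by (simp flip: ennreal_mult)
    finally show ?thesis .
  qed
qed simp

section \<open>Averaging over the centres of the balls\<close>

text \<open>
  The bound has the form \<open>\<epsilon> ^ N / (V * (\<epsilon> / 6) ^ N)\<close>: the bound for one ball of radius
  \<open>\<epsilon> / 6\<close>, divided by the volume of that ball.
\<close>

lemma nn_integral_cell_quotient_le:
  fixes w :: "real^'n \<Rightarrow> real"
  assumes \<eta>: "mollifier_kernel \<eta>" and w[measurable]: "w \<in> borel_measurable lebesgue"
    and per: "periodic_fun w" and nonneg: "AE x in lebesgue. 0 \<le> w x"
    and \<Omega>: "measurable_torus_set \<Omega>"
    and \<epsilon>: "0 < \<epsilon>" and pos: "\<And>x. x \<in> \<Omega> \<Longrightarrow> 0 < mollify \<eta> \<epsilon> w x"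
  shows "(\<integral>\<^sup>+x\<in>fund_cell. ennreal (w x / mollify \<eta> \<epsilon> w x) * indicator \<Omega> x \<partial>lebesgue)
    \<le> ennreal (6 ^ CARD('n) / unit_ball_vol (real CARD('n)))"
proof -
  define r where "r = \<epsilon> / 6"
  have r: "0 < r" using \<epsilon> by (simp add: r_def)
  define B :: "(real^'n) set" where "B = ball 0 r"
  define V where "V = unit_ball_vol (real CARD('n))"
  have V: "0 < V" by (simp add: V_def)
  have \<Omega>_sets[measurable]: "\<Omega> \<in> sets lebesgue" and \<Omega>_per: "periodic_fun (\<lambda>x. x \<in> \<Omega>)"
    using \<Omega> by (auto simp: measurable_torus_set_def)
  note [measurable] = borel_measurable_mollify[OF \<eta> w, of \<epsilon>]
  note m_per = periodic_fun_mollify[OF \<eta> w per, of \<epsilon>]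
  define g where "g = (\<lambda>x. ennreal (w x / mollify \<eta> \<epsilon> w x) * indicator \<Omega> x)"
  have g_meas[measurable]: "g \<in> borel_measurable lebesgue"
    unfolding g_def by measurable
  have g_per: "periodic_fun g"
    using per \<Omega>_per m_per by (simp add: periodic_fun_def g_def indicator_def)
  have local_bound: "(\<integral>\<^sup>+u\<in>B. g (x + u) \<partial>lebesgue) \<le> ennreal (\<epsilon> ^ CARD('n))" for x
  proof -
    have ball_sets[measurable]: "ball x r \<in> sets lebesgue" by simp
    have "(\<integral>\<^sup>+u\<in>B. g (x + u) \<partial>lebesgue)
        = (\<integral>\<^sup>+u. g (u + x) * indicator (ball x r) (u + x) \<partial>lebesgue)"
      by (intro nn_integral_cong) (auto simp: B_def indicator_def dist_norm add.commute)
    also have "\<dots> = (\<integral>\<^sup>+y\<in>ball x r. g y \<partial>lebesgue)"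
      by (intro nn_integral_lebesgue_translation borel_measurable_times_ennreal g_meas borel_measurable_indicator ball_sets)
    also have "\<dots> = (\<integral>\<^sup>+y\<in>\<Omega> \<inter> ball x r. ennreal (w y / mollify \<eta> \<epsilon> w y) \<partial>lebesgue)"
      by (intro nn_integral_cong) (auto simp: g_def indicator_def)
    also have "\<dots> \<le> ennreal (\<epsilon> ^ CARD('n))"
    proof (rule nn_integral_quotient_le)
      fix y assume y: "y \<in> \<Omega> \<inter> ball x r"
      show "(\<integral>\<^sup>+z\<in>\<Omega> \<inter> ball x r. ennreal (w z) \<partial>lebesgue) \<le> ennreal (\<epsilon> ^ CARD('n) * mollify \<eta> \<epsilon> w y)"
      proof (rule nn_integral_close_points_le_mollify[OF \<eta> w nonneg \<epsilon>])
        fix z assume z: "z \<in> \<Omega> \<inter> ball x r"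
        have "dist y z \<le> dist x y + dist x z" by (rule dist_triangle3)
        with y z show "norm (y - z) \<le> \<epsilon> / 3"
          by (simp add: r_def dist_norm)
      qed (use pos y in auto)
    qed (use pos \<epsilon> ball_sets in auto)
    finally show ?thesis .
  qed
  have "(\<integral>\<^sup>+x\<in>fund_cell. g x \<partial>lebesgue) * ennreal (V * r ^ CARD('n))
      = (\<integral>\<^sup>+u\<in>B. (\<integral>\<^sup>+x\<in>fund_cell. g x \<partial>lebesgue) \<partial>lebesgue)"
    by (subst nn_integral_cmult_indicator) (use r in \<open>simp_all add: B_def V_def emeasure_ball\<close>)
  also have "\<dots> = (\<integral>\<^sup>+u\<in>B. (\<integral>\<^sup>+x\<in>fund_cell. g (x + u) \<partial>lebesgue) \<partial>lebesgue)"
    by (simp only: nn_integral_cell_translate[OF g_meas g_per])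
  also have "\<dots> = (\<integral>\<^sup>+x\<in>fund_cell. (\<integral>\<^sup>+u\<in>B. g (x + u) \<partial>lebesgue) \<partial>lebesgue)"
    by (rule Tonelli_lebesgue_translation[symmetric]) (auto simp: B_def)
  also have "\<dots> \<le> (\<integral>\<^sup>+x\<in>(fund_cell :: (real^'n) set). ennreal (\<epsilon> ^ CARD('n)) \<partial>lebesgue)"
    by (rule nn_integral_mono, rule mult_right_mono[OF local_bound]) simp
  also have "\<dots> = ennreal (\<epsilon> ^ CARD('n)) * emeasure lebesgue (fund_cell :: (real^'n) set)"
    by (rule nn_integral_cmult_indicator) (simp add: sets_completionI_sets)
  also have "\<dots> \<le> ennreal (\<epsilon> ^ CARD('n)) * 1"
    by (intro mult_left_mono emeasure_fund_cell_le_1) auto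
  also have "\<dots> = ennreal (6 ^ CARD('n) / V) * ennreal (V * r ^ CARD('n))"
    using V r \<epsilon> by (simp flip: ennreal_mult add: r_def power_divide)
  finally have "(\<integral>\<^sup>+x\<in>fund_cell. g x \<partial>lebesgue) \<le> ennreal (6 ^ CARD('n) / V)"
    using V r by (simp add: mult.commute[of _ "ennreal (V * _)"] ennreal_mult_le_mult_iff)
  then show ?thesis by (simp add: g_def V_def)
qed

section \<open>The uniform bound\<close>

theorem lemma4p3:
  fixes \<eta> w :: "real^'n \<Rightarrow> real" and \<Omega> :: "(real^'n) set"
  assumes "mollifier_kernel \<eta>"
    and "torus_L1 UNIV w"
    and "AE x in lebesgue. 0 \<le> w x"
    and "measurable_torus_set \<Omega>"
    and "torus_measure \<Omega> \<noteq> 0"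
  shows "\<exists>C::real. \<forall>\<epsilon>>0. (\<forall>x\<in>\<Omega>. 0 < mollify \<eta> \<epsilon> w x) \<longrightarrow>
    torus_L1 \<Omega> (\<lambda>x. (mollify \<eta> \<epsilon> w x - w x) / mollify \<eta> \<epsilon> w x) \<and>
    torus_L1_norm \<Omega> (\<lambda>x. (mollify \<eta> \<epsilon> w x - w x) / mollify \<eta> \<epsilon> w x) \<le> C"
proof -
  define K where "K = 6 ^ CARD('n) / unit_ball_vol (real CARD('n))"
  have K: "0 \<le> K" by (simp add: K_def)
  have per: "periodic_fun w"
    using assms(2) by (simp add: torus_L1_def)
  have w[measurable]: "w \<in> borel_measurable lebesgue"
  proof (rule borel_measurable_lebesgue_if_periodic[OF per])
    show "(\<lambda>x. indicator fund_cell x * w x) \<in> borel_measurable lebesgue"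
      using assms(2) by (simp add: torus_L1_def set_integrable_def borel_measurable_integrable)
  qed
  have [measurable]: "\<Omega> \<in> sets lebesgue"
    using assms(4) by (simp add: measurable_torus_set_def)
  have [measurable]: "fund_cell \<in> sets (lebesgue :: (real^'n) measure)"
    by (simp add: sets_completionI_sets)
  show ?thesis
  proof (intro exI allI impI)
    fix \<epsilon> :: real assume \<epsilon>: "0 < \<epsilon>" and pos: "\<forall>x\<in>\<Omega>. 0 < mollify \<eta> \<epsilon> w x"
    define f where "f = (\<lambda>x. (mollify \<eta> \<epsilon> w x - w x) / mollify \<eta> \<epsilon> w x)"
    note [measurable] = borel_measurable_mollify[OF assms(1) w, of \<epsilon>]
    note m_per = periodic_fun_mollify[OF assms(1) w per, of \<epsilon>]
    have f_per: "periodic_fun f"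
      using per m_per by (simp add: periodic_fun_def f_def)
    have f_meas[measurable]: "f \<in> borel_measurable lebesgue"
      unfolding f_def by measurable
    let ?q = "\<lambda>x. ennreal (w x / mollify \<eta> \<epsilon> w x) * indicator \<Omega> x"
    have q_meas: "?q \<in> borel_measurable lebesgue"
      by measurable
    have "AE x in lebesgue. ennreal \<bar>indicator (\<Omega> \<inter> fund_cell) x * f x\<bar>
        \<le> indicator fund_cell x + ?q x * indicator fund_cell x"
      using assms(3)
    proof eventually_elim
      fix x assume w_nonneg: "0 \<le> w x"
      show "ennreal \<bar>indicator (\<Omega> \<inter> fund_cell) x * f x\<bar>
        \<le> indicator fund_cell x + ?q x * indicator fund_cell x"
      proof (cases "x \<in> \<Omega> \<inter> fund_cell")
        case True
        then have m: "0 < mollify \<eta> \<epsilon> w x" using pos by blast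
        then have "f x = 1 - w x / mollify \<eta> \<epsilon> w x"
          by (simp add: f_def diff_divide_distrib)
        moreover have "0 \<le> w x / mollify \<eta> \<epsilon> w x"
          using w_nonneg m by simp
        ultimately have "ennreal \<bar>f x\<bar> \<le> ennreal (1 + w x / mollify \<eta> \<epsilon> w x)"
          by (intro ennreal_leI) linarith
        with True w_nonneg m show ?thesis
          by (simp add: ennreal_plus)
      qed simp
    qed
    then have "(\<integral>\<^sup>+x. ennreal \<bar>indicator (\<Omega> \<inter> fund_cell) x * f x\<bar> \<partial>lebesgue)
        \<le> (\<integral>\<^sup>+x. indicator fund_cell x + ?q x * indicator fund_cell x \<partial>lebesgue)"
      by (rule nn_integral_mono_AE)
    also have "\<dots> = emeasure lebesgue (fund_cell :: (real^'n) set) + (\<integral>\<^sup>+x\<in>fund_cell. ?q x \<partial>lebesgue)"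
      using q_meas by (subst nn_integral_add) simp_all
    also have "\<dots> \<le> 1 + ennreal K"
      unfolding K_def using pos
      by (intro add_mono emeasure_fund_cell_le_1
        nn_integral_cell_quotient_le[OF assms(1) w per assms(3,4) \<epsilon>]) auto
    also have "\<dots> = ennreal (1 + K)"
      using K by (simp add: ennreal_plus)
    finally have bound: "(\<integral>\<^sup>+x. ennreal \<bar>indicator (\<Omega> \<inter> fund_cell) x * f x\<bar> \<partial>lebesgue) \<le> ennreal (1 + K)" .
    have "set_integrable lebesgue (\<Omega> \<inter> fund_cell) f"
      unfolding set_integrable_def
      using le_less_trans[OF bound ennreal_less_top]
      by (intro integrableI_bounded) auto
    moreover have "torus_L1_norm \<Omega> f \<le> 1 + K"
      unfolding torus_L1_norm_def set_lebesgue_integral_def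
      using bound K by (intro integral_real_bounded) (auto simp: abs_mult)
    ultimately show "torus_L1 \<Omega> (\<lambda>x. (mollify \<eta> \<epsilon> w x - w x) / mollify \<eta> \<epsilon> w x) \<and>
        torus_L1_norm \<Omega> (\<lambda>x. (mollify \<eta> \<epsilon> w x - w x) / mollify \<eta> \<epsilon> w x) \<le> 1 + K"
      using f_per by (simp add: torus_L1_def f_def)
  qed
qed

end
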